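(* Let $\theta_1,\theta_2\in(0,1)$ and $$\theta=\frac{\theta_1+\theta_2-2\theta_1\theta_2}{1-\theta_1\theta_2}.$$ Then $\mathcal{N}_{\theta_1}\mathcal{N}_{\theta_2}\subseteq\mathcal{N}_\theta$. Moreover, the averagedness coefficient $\theta$ is tight in the sense that it cannot be reduced without further assumptions: for every $\theta'\in(0,\theta)$, $\mathcal{N}_{\theta_1}\mathcal{N}_{\theta_2}\not\subseteq\mathcal{N}_{\theta'}$.
   Context: Hilbert spaces are real; $I$ is the identity. For $\theta\in(0,1)$, an operator $A:\mathcal{H}\to\mathcal{H}$ on a Hilbert space is $\theta$-averaged if $A=(1-\theta)I+\theta N$ for some nonexpansive (i.e. 1-Lipschitz) $N:\mathcal{H}\to\mathcal{H}$. $\mathcal{N}_\theta$ denotes the class of all $\theta$-averaged operators. Classes of operators consist of operators on arbitrary real Hilbert spaces (different members of a class may act on different Hilbert spaces). $\mathcal{N}_{\theta_1}\mathcal{N}_{\theta_2}=\{N_1N_2 \mid N_1\in\mathcal{N}_{\theta_1},\,N_2\in\mathcal{N}_{\theta_2}\}$, where $N_1,N_2$ act on the same Hilbert space and $N_1N_2$ is composition. *)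

theory Defs
  imports "HOL-Analysis.Analysis" "HOL-Algebra.Algebraic_Closure_Type"
begin

(* Classes such as N_theta contain operators on arbitrary real Hilbert spaces, so one class
   mixes operators living on different spaces.  A Hilbert space is therefore a structure with an
   explicit carrier set (as in HOL-Algebra), not an instance of a type class.  The unused fields
   mult and one are inherited from the record of rings, as for every HOL-Algebra module. *)

abbreviation real_ring :: "real ring"
  where "real_ring \<equiv> ring_of_type_algebra"

record 'a inner_space = "(real, 'a) module" +
  ip :: "'a \<Rightarrow> 'a \<Rightarrow> real"

locale inner_product_space = Module.module real_ring H
  for H :: "'a inner_space" (structure) +
  assumes ip_commute: "\<lbrakk>x \<in> carrier H; y \<in> carrier H\<rbrakk> \<Longrightarrow> ip H x y = ip H y x"
    and ip_add_left:
      "\<lbrakk>x \<in> carrier H; y \<in> carrier H; z \<in> carrier H\<rbrakk>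
        \<Longrightarrow> ip H (x \<oplus>\<^bsub>H\<^esub> y) z = ip H x z + ip H y z"
    and ip_smult_left:
      "\<lbrakk>x \<in> carrier H; y \<in> carrier H\<rbrakk> \<Longrightarrow> ip H (a \<odot>\<^bsub>H\<^esub> x) y = a * ip H x y"
    and ip_nonneg: "x \<in> carrier H \<Longrightarrow> 0 \<le> ip H x x"
    and ip_definite: "\<lbrakk>x \<in> carrier H; ip H x x = 0\<rbrakk> \<Longrightarrow> x = \<zero>\<^bsub>H\<^esub>"

(* The locale Metric_space asks for nonnegativity and symmetry on the whole type, hence the
   default value outside the carrier. *)
definition hdist :: "'a inner_space \<Rightarrow> 'a \<Rightarrow> 'a \<Rightarrow> real"
  where "hdist H x y =
    (if x \<in> carrier H \<and> y \<in> carrier H then sqrt (ip H (x \<ominus>\<^bsub>H\<^esub> y) (x \<ominus>\<^bsub>H\<^esub> y)) else 0)"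

locale hilbert_space = inner_product_space +
  assumes complete: "Metric_space.mcomplete (carrier H) (hdist H)"

(* An operator on H is a function on the carrier, made canonical (extensional) by
   the value undefined elsewhere. *)
definition nonexpansive :: "'a inner_space \<Rightarrow> ('a \<Rightarrow> 'a) \<Rightarrow> bool"
  where "nonexpansive H N \<longleftrightarrow> N \<in> carrier H \<rightarrow>\<^sub>E carrier H \<and>
    (\<forall>x\<in>carrier H. \<forall>y\<in>carrier H. hdist H (N x) (N y) \<le> hdist H x y)"

definition averaged :: "'a inner_space \<Rightarrow> real \<Rightarrow> ('a \<Rightarrow> 'a) \<Rightarrow> bool"
  where "averaged H \<theta> A \<longleftrightarrow> 0 < \<theta> \<and> \<theta> < 1 \<and>
    (\<exists>N. nonexpansive H N \<and>
      A = (\<lambda>x\<in>carrier H. ((1 - \<theta>) \<odot>\<^bsub>H\<^esub> x) \<oplus>\<^bsub>H\<^esub> (\<theta> \<odot>\<^bsub>H\<^esub> N x)))"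

type_synonym 'a op_class = "('a inner_space \<times> ('a \<Rightarrow> 'a)) set"

(* HOL cannot collect the spaces over all types in one set; the type 'a is the universe
   from which the points of the Hilbert spaces are taken.  A universe with fewer points than
   the real line contains only zero spaces, so claims that some Hilbert space exists need the
   hypothesis UNIV :: real set \<lesssim> UNIV :: 'a set. *)
definition averaged_class :: "real \<Rightarrow> 'a op_class"
  where "averaged_class \<theta> = {(H, A). hilbert_space H \<and> averaged H \<theta> A}"

definition class_comp :: "'a op_class \<Rightarrow> 'a op_class \<Rightarrow> 'a op_class"
  where "class_comp C D =
    {(H, compose (carrier H) A B) | H A B. (H, A) \<in> C \<and> (H, B) \<in> D}"


lemma real_ring_simps [simp]:
  "carrier real_ring = UNIV" "x \<otimes>\<^bsub>real_ring\<^esub> y = x * y" "\<one>\<^bsub>real_ring\<^esub> = 1"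
  "\<zero>\<^bsub>real_ring\<^esub> = 0" "x \<oplus>\<^bsub>real_ring\<^esub> y = x + y"
  by (simp_all add: ring_of_type_algebra_def)

context inner_product_space
begin

lemma minus_eq_smult: "x \<in> carrier H \<Longrightarrow> \<ominus>\<^bsub>H\<^esub> x = (-1) \<odot>\<^bsub>H\<^esub> x"
proof -
  assume x: "x \<in> carrier H"
  have "(-1) \<odot>\<^bsub>H\<^esub> x \<oplus>\<^bsub>H\<^esub> x = ((-1) \<oplus>\<^bsub>real_ring\<^esub> 1) \<odot>\<^bsub>H\<^esub> x"
    using x smult_l_distr[of "-1" 1 x] smult_one[of x] by simp
  also have "\<dots> = \<zero>\<^bsub>H\<^esub>"
    using x smult_l_null[of x] by simp
  finally show ?thesis
    using x M.minus_equality[of "(-1) \<odot>\<^bsub>H\<^esub> x" x] by simp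
qed

lemma ip_add_right:
  "\<lbrakk>x \<in> carrier H; y \<in> carrier H; z \<in> carrier H\<rbrakk>
    \<Longrightarrow> ip H z (x \<oplus>\<^bsub>H\<^esub> y) = ip H z x + ip H z y"
  by (metis M.a_closed ip_add_left ip_commute)

lemma ip_smult_right:
  "\<lbrakk>x \<in> carrier H; y \<in> carrier H\<rbrakk> \<Longrightarrow> ip H y (a \<odot>\<^bsub>H\<^esub> x) = a * ip H y x"
  by (metis ip_commute ip_smult_left real_ring_simps(1) UNIV_I smult_closed)

lemma ip_Cauchy_Schwarz:
  assumes x: "x \<in> carrier H" and y: "y \<in> carrier H"
  shows "(ip H x y)\<^sup>2 \<le> ip H x x * ip H y y"
proof -
  have sq: "0 \<le> ip H x x + 2 * t * ip H x y + t\<^sup>2 * ip H y y" for t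
  proof -
    have "0 \<le> ip H (x \<oplus>\<^bsub>H\<^esub> (t \<odot>\<^bsub>H\<^esub> y)) (x \<oplus>\<^bsub>H\<^esub> (t \<odot>\<^bsub>H\<^esub> y))"
      using x y by (simp add: ip_nonneg)
    also have "\<dots> = ip H x x + 2 * t * ip H x y + t\<^sup>2 * ip H y y"
      using x y ip_commute[of y x]
      by (simp add: ip_add_left ip_add_right ip_smult_left ip_smult_right
          power2_eq_square algebra_simps)
    finally show ?thesis .
  qed
  show ?thesis
  proof (cases "ip H y y = 0")
    case True
    then have y0: "y = \<zero>\<^bsub>H\<^esub>" using y ip_definite by blast
    have "ip H y x + ip H y x = ip H y x"
      using x y0 ip_add_left[of y y x] y by simp
    then show ?thesis using True x y ip_commute[of y x] by simp
  next
    case False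
    then have pos: "ip H y y > 0" using ip_nonneg[OF y] by simp
    have "0 \<le> ip H x x - (ip H x y)\<^sup>2 / ip H y y"
      using sq[of "- ip H x y / ip H y y"] pos by (simp add: power2_eq_square field_simps)
    then show ?thesis using pos by (simp add: field_simps)
  qed
qed

lemma Metric_space: "Metric_space (carrier H) (hdist H)"
proof
  show "0 \<le> hdist H x y" for x y
    by (simp add: hdist_def ip_nonneg)
  have sym: "ip H (x \<ominus>\<^bsub>H\<^esub> y) (x \<ominus>\<^bsub>H\<^esub> y) = ip H (y \<ominus>\<^bsub>H\<^esub> x) (y \<ominus>\<^bsub>H\<^esub> x)"
    if "x \<in> carrier H" "y \<in> carrier H" for x y
    using that ip_commute[of x y]
    by (simp add: M.minus_eq minus_eq_smult ip_add_left ip_add_right ip_smult_left ip_smult_right)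
  then show "hdist H x y = hdist H y x" for x y
    by (simp add: hdist_def)
  have zero: "ip H \<zero>\<^bsub>H\<^esub> \<zero>\<^bsub>H\<^esub> = 0"
    using ip_add_left[of "\<zero>\<^bsub>H\<^esub>" "\<zero>\<^bsub>H\<^esub>" "\<zero>\<^bsub>H\<^esub>"] by simp
  show "hdist H x y = 0 \<longleftrightarrow> x = y" if "x \<in> carrier H" "y \<in> carrier H" for x y
  proof
    assume "hdist H x y = 0"
    then have "x \<ominus>\<^bsub>H\<^esub> y = \<zero>\<^bsub>H\<^esub>"
      using that ip_definite[of "x \<ominus>\<^bsub>H\<^esub> y"] by (simp add: hdist_def)
    then show "x = y"
      using that M.minus_equality[of x "\<ominus>\<^bsub>H\<^esub> y"] M.minus_minus[of y] by (simp add: M.minus_eq)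
  next
    assume "x = y"
    then show "hdist H x y = 0"
      using that zero by (simp add: hdist_def M.minus_eq M.r_neg)
  qed
  show "hdist H x z \<le> hdist H x y + hdist H y z"
    if xyz: "x \<in> carrier H" "y \<in> carrier H" "z \<in> carrier H" for x y z
  proof -
    define u where "u = x \<ominus>\<^bsub>H\<^esub> y"
    define v where "v = y \<ominus>\<^bsub>H\<^esub> z"
    have uv: "u \<in> carrier H" "v \<in> carrier H" using xyz by (auto simp: u_def v_def)
    have "x \<ominus>\<^bsub>H\<^esub> z = u \<oplus>\<^bsub>H\<^esub> v"
      using xyz by (simp add: u_def v_def M.minus_eq M.a_assoc M.r_neg1)
    then have "hdist H x z = sqrt (ip H u u + 2 * ip H u v + ip H v v)"
      using uv xyz ip_commute[of v u] by (simp add: hdist_def ip_add_left ip_add_right)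
    also have "\<dots> \<le> sqrt (ip H u u) + sqrt (ip H v v)"
    proof (rule real_le_lsqrt)
      have "\<bar>ip H u v\<bar> \<le> sqrt (ip H u u * ip H v v)"
        using ip_Cauchy_Schwarz[OF uv] by (simp add: real_le_rsqrt)
      then show "ip H u u + 2 * ip H u v + ip H v v \<le> (sqrt (ip H u u) + sqrt (ip H v v))\<^sup>2"
        using ip_nonneg uv by (simp add: power2_sum real_sqrt_mult)
    qed (use ip_nonneg uv in simp)
    finally show ?thesis using xyz by (simp add: hdist_def u_def v_def)
  qed
qed

end

(* Every Hilbert space in the sense of the type classes is one of these structures. *)

definition type_inner_space :: "'a::real_inner inner_space"
  where "type_inner_space = \<lparr>carrier = UNIV, monoid.mult = (\<lambda>_ _. 0), one = 0, ring.zero = 0,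
    add = (+), smult = scaleR, ip = inner\<rparr>"

lemma hilbert_space_type:
  "hilbert_space (type_inner_space :: 'a::{real_inner, complete_space} inner_space)"
proof -
  let ?H = "type_inner_space :: 'a inner_space"
  have grp: "abelian_group ?H"
    by (rule abelian_groupI)
      (auto simp: type_inner_space_def algebra_simps intro: exI[of _ "- x" for x])
  have mod: "Module.module real_ring ?H"
    by (rule Module.moduleI[OF _ grp])
      (auto simp: type_inner_space_def algebra_simps)
  interpret inner_product_space ?H
    by (intro inner_product_space.intro mod inner_product_space_axioms.intro)
      (auto simp: type_inner_space_def inner_add_left intro: inner_commute)
  have "\<ominus>\<^bsub>?H\<^esub> y = - y" for y :: 'a
    using minus_eq_smult[of y] by (simp add: type_inner_space_def)
  then have "hdist ?H = dist"
    by (intro ext) (simp add: hdist_def M.minus_eq dist_norm norm_eq_sqrt_inner,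
        simp add: type_inner_space_def)
  moreover have "carrier ?H = UNIV" by (simp add: type_inner_space_def)
  ultimately have "Metric_space.mcomplete (carrier ?H) (hdist ?H)"
    using complete_UNIV mcomplete_iff_complete by metis
  then show ?thesis
    by (intro hilbert_space.intro inner_product_space_axioms hilbert_space_axioms.intro)
qed

end

theory Submission
  imports Defs
begin

(* With u = x - y and v = A x - A y, averagedness of A says |v|^2 + k |u - v|^2 <= |u|^2, where
   k = 1/\<theta> - 1.  Adding these inequalities for the two factors, with constants p and q, and
   using p |a|^2 + q |b|^2 >= (p q/(p + q)) |a + b|^2 gives the one for the composition, with
   constant p q/(p + q).
   For tightness take multiplications by complex numbers 1 + 1/z: such an operator is
   \<theta>-averaged iff Re z <= - 1/(2 \<theta>).  Let z = (p s - 1)/2 and z' = (q s - 1)/2 with Re s = - 1.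
   As Im s grows, the best averagedness coefficient of the product tends to \<theta>. *)

section \<open>Averagedness as an inequality between inner products\<close>

context inner_product_space
begin

lemma minus_lincomb:
  assumes "x \<in> carrier H" "y \<in> carrier H" "x' \<in> carrier H" "y' \<in> carrier H"
  shows "(a \<odot>\<^bsub>H\<^esub> x \<oplus>\<^bsub>H\<^esub> b \<odot>\<^bsub>H\<^esub> y) \<ominus>\<^bsub>H\<^esub> (a \<odot>\<^bsub>H\<^esub> x' \<oplus>\<^bsub>H\<^esub> b \<odot>\<^bsub>H\<^esub> y')
    = a \<odot>\<^bsub>H\<^esub> (x \<ominus>\<^bsub>H\<^esub> x') \<oplus>\<^bsub>H\<^esub> b \<odot>\<^bsub>H\<^esub> (y \<ominus>\<^bsub>H\<^esub> y')"
  using assms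
  by (simp add: M.minus_eq smult_r_distr smult_r_minus M.minus_add M.a_ac)

text \<open>Read with \<open>y = A x\<close> and \<open>n = N x\<close>: the operator
  \<open>N\<close> in the definition of \<open>averaged\<close> is determined by \<open>A\<close>
  and \<theta>, and the right-hand side computes it.\<close>

lemma lincomb_eq_iff:
  assumes "x \<in> carrier H" "y \<in> carrier H" "n \<in> carrier H" "\<theta> \<noteq> 0"
  shows "y = ((1 - \<theta>) \<odot>\<^bsub>H\<^esub> x) \<oplus>\<^bsub>H\<^esub> (\<theta> \<odot>\<^bsub>H\<^esub> n)
    \<longleftrightarrow> n = ((1 / \<theta>) \<odot>\<^bsub>H\<^esub> y) \<oplus>\<^bsub>H\<^esub> ((1 - 1 / \<theta>) \<odot>\<^bsub>H\<^esub> x)" (is "?l \<longleftrightarrow> ?r")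
proof -
  \<comment> \<open>The module laws with scalars combined by ordinary real arithmetic;
    \<open>distr\<close> merges neighbouring multiples of \<open>z\<close> inside a longer
    sum.\<close>
  have assoc: "a \<odot>\<^bsub>H\<^esub> (b \<odot>\<^bsub>H\<^esub> z) = (a * b) \<odot>\<^bsub>H\<^esub> z" if "z \<in> carrier H" for a b z
    using smult_assoc1[of a b z] that by simp
  have distr: "a \<odot>\<^bsub>H\<^esub> z \<oplus>\<^bsub>H\<^esub> (b \<odot>\<^bsub>H\<^esub> z \<oplus>\<^bsub>H\<^esub> c) = (a + b) \<odot>\<^bsub>H\<^esub> z \<oplus>\<^bsub>H\<^esub> c"
    if "z \<in> carrier H" "c \<in> carrier H" for a b c z
    using smult_l_distr[of a b z] that by (simp add: M.a_assoc)
  have distr0: "a \<odot>\<^bsub>H\<^esub> z \<oplus>\<^bsub>H\<^esub> b \<odot>\<^bsub>H\<^esub> z = (a + b) \<odot>\<^bsub>H\<^esub> z" if "z \<in> carrier H" for a b z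
    using smult_l_distr[of a b z] that by simp
  have null: "0 \<odot>\<^bsub>H\<^esub> z = \<zero>\<^bsub>H\<^esub>" and one: "1 \<odot>\<^bsub>H\<^esub> z = z" if "z \<in> carrier H" for z
    using smult_l_null[of z] smult_one[of z] that by simp_all
  show ?thesis
  proof
    assume ?l
    moreover have "1 / \<theta> * (1 - \<theta>) + (1 - 1 / \<theta>) = 0"
      using assms(4) by (simp add: field_simps)
    ultimately show ?r
      using assms distr0[of x "1 / \<theta> * (1 - \<theta>)" "1 - 1 / \<theta>"]
      by (simp add: smult_r_distr assoc M.a_ac null one distr0 distr)
  next
    assume ?r
    moreover have "(1 - \<theta>) + \<theta> * (1 - 1 / \<theta>) = 0"
      using assms(4) by (simp add: field_simps)
    ultimately show ?l
      using assms distr0[of x "1 - \<theta>" "\<theta> * (1 - 1 / \<theta>)"]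
      by (simp add: smult_r_distr assoc M.a_ac null one distr0 distr)
  qed
qed

text \<open>The only candidate for \<open>N\<close> is \<open>?n\<close>, so \<open>A\<close> is
  averaged iff \<open>?n\<close> is nonexpansive. The inequality is the expansion of
  |\<open>?n\<close> x - \<open>?n\<close> y|^2 <= |x - y|^2, cleared of denominators. It no longer
  quantifies over \<open>N\<close>.\<close>

lemma averaged_iff:
  "averaged H \<theta> A \<longleftrightarrow> 0 < \<theta> \<and> \<theta> < 1 \<and> A \<in> carrier H \<rightarrow>\<^sub>E carrier H \<and>
    (\<forall>x\<in>carrier H. \<forall>y\<in>carrier H.
      ip H (A x \<ominus>\<^bsub>H\<^esub> A y) (A x \<ominus>\<^bsub>H\<^esub> A y) + (1 - 2 * \<theta>) * ip H (x \<ominus>\<^bsub>H\<^esub> y) (x \<ominus>\<^bsub>H\<^esub> y)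
        \<le> 2 * (1 - \<theta>) * ip H (x \<ominus>\<^bsub>H\<^esub> y) (A x \<ominus>\<^bsub>H\<^esub> A y))"
    (is "_ \<longleftrightarrow> _ \<and> _ \<and> _ \<and> (\<forall>x\<in>_. \<forall>y\<in>_. ?P x y)")
proof -
  let ?n = "\<lambda>x. ((1 / \<theta>) \<odot>\<^bsub>H\<^esub> A x) \<oplus>\<^bsub>H\<^esub> ((1 - 1 / \<theta>) \<odot>\<^bsub>H\<^esub> x)"
  have key: "hdist H (?n x) (?n y) \<le> hdist H x y \<longleftrightarrow> ?P x y"
    if "0 < \<theta>" "x \<in> carrier H" "y \<in> carrier H" "A x \<in> carrier H" "A y \<in> carrier H" for x y
  proof -
    define u where "u = x \<ominus>\<^bsub>H\<^esub> y"
    define v where "v = A x \<ominus>\<^bsub>H\<^esub> A y"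
    have uv: "u \<in> carrier H" "v \<in> carrier H" using that by (auto simp: u_def v_def)
    have "?n x \<ominus>\<^bsub>H\<^esub> ?n y = (1 / \<theta>) \<odot>\<^bsub>H\<^esub> v \<oplus>\<^bsub>H\<^esub> (1 - 1 / \<theta>) \<odot>\<^bsub>H\<^esub> u"
      unfolding u_def v_def by (intro minus_lincomb) (use that in auto)
    moreover have "ip H (a \<odot>\<^bsub>H\<^esub> v \<oplus>\<^bsub>H\<^esub> b \<odot>\<^bsub>H\<^esub> u) (a \<odot>\<^bsub>H\<^esub> v \<oplus>\<^bsub>H\<^esub> b \<odot>\<^bsub>H\<^esub> u)
        = a\<^sup>2 * ip H v v + 2 * a * b * ip H u v + b\<^sup>2 * ip H u u" for a b
      using uv ip_commute[of v u]
      by (simp add: ip_add_left ip_add_right ip_smult_left ip_smult_right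
          power2_eq_square algebra_simps)
    ultimately have "hdist H (?n x) (?n y) = sqrt ((1 / \<theta>)\<^sup>2 * ip H v v
        + 2 * (1 / \<theta>) * (1 - 1 / \<theta>) * ip H u v + (1 - 1 / \<theta>)\<^sup>2 * ip H u u)"
      using that by (simp add: hdist_def)
    moreover have "hdist H x y = sqrt (ip H u u)"
      using that by (simp add: hdist_def u_def)
    moreover have "(1 / \<theta>)\<^sup>2 * a + 2 * (1 / \<theta>) * (1 - 1 / \<theta>) * b + (1 - 1 / \<theta>)\<^sup>2 * c \<le> c
      \<longleftrightarrow> a + (1 - 2 * \<theta>) * c \<le> 2 * (1 - \<theta>) * b" for a b c
    proof -
      \<comment> \<open>Multiplication by the positive number \<open>\<theta>\<^sup>2\<close>
        preserves the sign of the difference of the two sides.\<close>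
      have "\<theta>\<^sup>2 * ((1 / \<theta>)\<^sup>2 * a + 2 * (1 / \<theta>) * (1 - 1 / \<theta>) * b + (1 - 1 / \<theta>)\<^sup>2 * c - c)
        = a + (1 - 2 * \<theta>) * c - 2 * (1 - \<theta>) * b"
        using that(1) by (simp add: power2_eq_square field_simps)
      then show ?thesis
        using that(1) by (smt (verit) mult_le_0_iff zero_less_power)
    qed
    ultimately show ?thesis by (simp add: u_def v_def)
  qed
  show ?thesis
  proof (intro iffI conjI ballI)
    assume av: "averaged H \<theta> A"
    then show th: "0 < \<theta>" "\<theta> < 1" by (auto simp: averaged_def)
    from av obtain N where N: "nonexpansive H N"
      and A: "A = (\<lambda>x\<in>carrier H. ((1 - \<theta>) \<odot>\<^bsub>H\<^esub> x) \<oplus>\<^bsub>H\<^esub> (\<theta> \<odot>\<^bsub>H\<^esub> N x))"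
      by (auto simp: averaged_def)
    have Nc: "N x \<in> carrier H" if "x \<in> carrier H" for x
      using N that by (auto simp: nonexpansive_def)
    then show AE: "A \<in> carrier H \<rightarrow>\<^sub>E carrier H" by (auto simp: A)
    fix x y assume xy: "x \<in> carrier H" "y \<in> carrier H"
    have Neq: "N x = ?n x" if "x \<in> carrier H" for x
    proof -
      have "A x = ((1 - \<theta>) \<odot>\<^bsub>H\<^esub> x) \<oplus>\<^bsub>H\<^esub> (\<theta> \<odot>\<^bsub>H\<^esub> N x)" using that by (simp add: A)
      then show ?thesis
        using lincomb_eq_iff[of x "A x" "N x" \<theta>] that Nc AE th by (auto simp: PiE_mem)
    qed
    have "hdist H (?n x) (?n y) \<le> hdist H x y"
      using N xy unfolding nonexpansive_def by (metis Neq)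
    then show "?P x y" using key[of x y] th xy AE by (auto simp: PiE_mem)
  next
    assume R: "0 < \<theta> \<and> \<theta> < 1 \<and> A \<in> carrier H \<rightarrow>\<^sub>E carrier H \<and> (\<forall>x\<in>carrier H. \<forall>y\<in>carrier H. ?P x y)"
    then have Ac: "A x \<in> carrier H" if "x \<in> carrier H" for x
      using that by (auto simp: PiE_mem)
    \<comment> \<open>The witness for \<open>N\<close>. Restriction makes it extensional, as
      \<open>nonexpansive\<close> demands.\<close>
    have "nonexpansive H (restrict ?n (carrier H))"
      unfolding nonexpansive_def using R key Ac by auto
    moreover have "A = (\<lambda>x\<in>carrier H. ((1 - \<theta>) \<odot>\<^bsub>H\<^esub> x) \<oplus>\<^bsub>H\<^esub> (\<theta> \<odot>\<^bsub>H\<^esub> restrict ?n (carrier H) x))"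
    proof (rule extensionalityI)
      show "A \<in> extensional (carrier H)" using R by (auto simp: PiE_def)
    next
      fix x assume x: "x \<in> carrier H"
      then show "A x = (\<lambda>x\<in>carrier H. ((1 - \<theta>) \<odot>\<^bsub>H\<^esub> x) \<oplus>\<^bsub>H\<^esub> (\<theta> \<odot>\<^bsub>H\<^esub> restrict ?n (carrier H) x)) x"
        using lincomb_eq_iff[of x "A x" "?n x" \<theta>] R Ac by simp
    qed (rule restrict_extensional)
    ultimately show "averaged H \<theta> A" using R unfolding averaged_def by blast
  qed
qed

end

section \<open>Composition of two averaged operators\<close>

text \<open>In terms of 1/\<theta> - 1 the formula for the coefficient is a parallel sum: the
  reciprocals 1/p and 1/q add. Both the composition estimate and the tightness example produce the
  constant in the form p q/(p + q).\<close>

lemma averaged_coefficient_inverse: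
  fixes \<theta>\<^sub>1 \<theta>\<^sub>2 \<theta> :: real
  assumes "\<theta>\<^sub>1 \<in> {0<..<1}" "\<theta>\<^sub>2 \<in> {0<..<1}"
    and "\<theta> = (\<theta>\<^sub>1 + \<theta>\<^sub>2 - 2 * \<theta>\<^sub>1 * \<theta>\<^sub>2) / (1 - \<theta>\<^sub>1 * \<theta>\<^sub>2)"
    and "p = 1 / \<theta>\<^sub>1 - 1" "q = 1 / \<theta>\<^sub>2 - 1"
  shows "p > 0" "q > 0" "0 < \<theta>" "\<theta> < 1" "1 / \<theta> = 1 + p * q / (p + q)"
proof -
  show "p > 0" "q > 0" using assms by simp_all
  have d: "0 < 1 - \<theta>\<^sub>1 * \<theta>\<^sub>2" using assms(1,2) mult_strict_mono[of \<theta>\<^sub>1 1 \<theta>\<^sub>2 1] by simp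
  have e: "\<theta>\<^sub>1 + \<theta>\<^sub>2 - 2 * \<theta>\<^sub>1 * \<theta>\<^sub>2 = \<theta>\<^sub>1 * (1 - \<theta>\<^sub>2) + \<theta>\<^sub>2 * (1 - \<theta>\<^sub>1)" by (simp add: algebra_simps)
  have n: "0 < \<theta>\<^sub>1 + \<theta>\<^sub>2 - 2 * \<theta>\<^sub>1 * \<theta>\<^sub>2" unfolding e using assms(1,2) by (simp add: add_pos_pos)
  show "0 < \<theta>" using d n assms(3) by simp
  \<comment> \<open>This product is the denominator of \<theta> minus its numerator.\<close>
  have "0 < (1 - \<theta>\<^sub>1) * (1 - \<theta>\<^sub>2)" using assms(1,2) by simp
  then show "\<theta> < 1" unfolding assms(3) using d by (simp add: field_simps)
  have "p + q = (\<theta>\<^sub>1 + \<theta>\<^sub>2 - 2 * \<theta>\<^sub>1 * \<theta>\<^sub>2) / (\<theta>\<^sub>1 * \<theta>\<^sub>2)"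
    "p * q = (1 - \<theta>\<^sub>1) * (1 - \<theta>\<^sub>2) / (\<theta>\<^sub>1 * \<theta>\<^sub>2)"
    unfolding assms(4,5) using assms(1,2) by (simp_all add: field_simps)
  then have "p * q / (p + q) = (1 - \<theta>\<^sub>1) * (1 - \<theta>\<^sub>2) / (\<theta>\<^sub>1 + \<theta>\<^sub>2 - 2 * \<theta>\<^sub>1 * \<theta>\<^sub>2)"
    using assms(1,2) by simp
  moreover have "1 / \<theta> = (1 - \<theta>\<^sub>1 * \<theta>\<^sub>2) / (\<theta>\<^sub>1 + \<theta>\<^sub>2 - 2 * \<theta>\<^sub>1 * \<theta>\<^sub>2)"
    unfolding assms(3) by simp
  moreover have "(1 - \<theta>\<^sub>1 * \<theta>\<^sub>2) / k = 1 + (1 - \<theta>\<^sub>1) * (1 - \<theta>\<^sub>2) / k"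
    if "k = \<theta>\<^sub>1 + \<theta>\<^sub>2 - 2 * \<theta>\<^sub>1 * \<theta>\<^sub>2" "k > 0" for k
    using that(2) by (simp add: divide_simps) (simp add: that(1) algebra_simps)
  ultimately show "1 / \<theta> = 1 + p * q / (p + q)"
    using n by simp
qed

lemma (in inner_product_space) averaged_compose:
  assumes A: "averaged H \<theta>\<^sub>1 A" and B: "averaged H \<theta>\<^sub>2 B"
    and \<theta>: "\<theta> = (\<theta>\<^sub>1 + \<theta>\<^sub>2 - 2 * \<theta>\<^sub>1 * \<theta>\<^sub>2) / (1 - \<theta>\<^sub>1 * \<theta>\<^sub>2)"
  shows "averaged H \<theta> (compose (carrier H) A B)"
proof -
  define p q where "p = 1 / \<theta>\<^sub>1 - 1" and "q = 1 / \<theta>\<^sub>2 - 1"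
  have th: "\<theta>\<^sub>1 \<in> {0<..<1}" "\<theta>\<^sub>2 \<in> {0<..<1}" using A B by (auto simp: averaged_def)
  note c = averaged_coefficient_inverse[OF th \<theta> p_def q_def]
  have inv: "1 / \<theta>\<^sub>1 = 1 + p" "1 / \<theta>\<^sub>2 = 1 + q" by (simp_all add: p_def q_def)
  have Ac: "A x \<in> carrier H" and Bc: "B x \<in> carrier H" if "x \<in> carrier H" for x
    using A B that unfolding averaged_iff by (auto simp: PiE_mem)
  \<comment> \<open>Passes from the form in \<open>averaged_iff\<close> to the one with k = 1/t - 1,
    by multiplying with t. For a = |v|^2, b = <u, v> and c = |u|^2 the bracket a - 2 b + c is |u -
    v|^2.\<close>
  have scale: "a + (1 - 2 * t) * c \<le> 2 * (1 - t) * b \<longleftrightarrow> a + k * (a - 2 * b + c) \<le> c"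
    if "1 / t = 1 + k" "0 < t" for a b c t k :: real
  proof -
    have k: "k = 1 / t - 1" using that by simp
    have "t * (a + k * (a - 2 * b + c) - c) = a + (1 - 2 * t) * c - 2 * (1 - t) * b"
      using that unfolding k by (simp add: field_simps)
    then show ?thesis
      using that by (smt (verit) mult_le_0_iff)
  qed
  show ?thesis
    unfolding averaged_iff
  proof (intro conjI ballI c)
    show "compose (carrier H) A B \<in> carrier H \<rightarrow>\<^sub>E carrier H"
      using Ac Bc by (auto simp: compose_def)
    fix x y assume xy: "x \<in> carrier H" "y \<in> carrier H"
    define u where "u = x \<ominus>\<^bsub>H\<^esub> y"
    define v where "v = B x \<ominus>\<^bsub>H\<^esub> B y"
    define w where "w = A (B x) \<ominus>\<^bsub>H\<^esub> A (B y)"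
    have carr: "u \<in> carrier H" "v \<in> carrier H" "w \<in> carrier H"
      using xy Ac Bc by (auto simp: u_def v_def w_def)
    have 1: "ip H w w + p * (ip H w w - 2 * ip H v w + ip H v v) \<le> ip H v v"
      using A xy Bc th scale[OF inv(1)] unfolding averaged_iff v_def w_def by auto
    have 2: "ip H v v + q * (ip H v v - 2 * ip H u v + ip H u u) \<le> ip H u u"
      using B xy th scale[OF inv(2)] unfolding averaged_iff u_def v_def by auto
    \<comment> \<open>\<open>p |a|\<^sup>2 + q |b|\<^sup>2 - (p q / (p + q)) |a + b|\<^sup>2 = |p a - q b|\<^sup>2 / (p + q)\<close>
        for \<open>a = v - w\<close>, \<open>b = u - v\<close>\<close>
    have "0 \<le> ip H (((p + q) \<odot>\<^bsub>H\<^esub> v) \<oplus>\<^bsub>H\<^esub> (((-p) \<odot>\<^bsub>H\<^esub> w) \<oplus>\<^bsub>H\<^esub> ((-q) \<odot>\<^bsub>H\<^esub> u)))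
        (((p + q) \<odot>\<^bsub>H\<^esub> v) \<oplus>\<^bsub>H\<^esub> (((-p) \<odot>\<^bsub>H\<^esub> w) \<oplus>\<^bsub>H\<^esub> ((-q) \<odot>\<^bsub>H\<^esub> u)))"
      by (intro ip_nonneg) (use carr in auto)
    also have "\<dots> = (p + q) * (p * (ip H w w - 2 * ip H v w + ip H v v)
          + q * (ip H v v - 2 * ip H u v + ip H u u))
        - p * q * (ip H w w - 2 * ip H u w + ip H u u)"
      using carr ip_commute[of v u] ip_commute[of w u] ip_commute[of w v]
      by (simp add: ip_add_left ip_add_right ip_smult_left ip_smult_right algebra_simps)
    finally have "p * q / (p + q) * (ip H w w - 2 * ip H u w + ip H u u)
        \<le> p * (ip H w w - 2 * ip H v w + ip H v v) + q * (ip H v v - 2 * ip H u v + ip H u u)"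
      using c(1,2) by (simp add: pos_divide_le_eq mult.commute)
    \<comment> \<open>On adding \<open>1\<close> and \<open>2\<close>, |v|^2 cancels, and the
      intermediate point survives only in the two bracketed terms just estimated.\<close>
    with 1 2 have "ip H w w + p * q / (p + q) * (ip H w w - 2 * ip H u w + ip H u u) \<le> ip H u u"
      by linarith
    then have "ip H w w + (1 - 2 * \<theta>) * ip H u u \<le> 2 * (1 - \<theta>) * ip H u w"
      using scale[OF c(5,3)] by blast
    then show "ip H (compose (carrier H) A B x \<ominus>\<^bsub>H\<^esub> compose (carrier H) A B y)
          (compose (carrier H) A B x \<ominus>\<^bsub>H\<^esub> compose (carrier H) A B y)
        + (1 - 2 * \<theta>) * ip H (x \<ominus>\<^bsub>H\<^esub> y) (x \<ominus>\<^bsub>H\<^esub> y)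
      \<le> 2 * (1 - \<theta>) * ip H (x \<ominus>\<^bsub>H\<^esub> y)
          (compose (carrier H) A B x \<ominus>\<^bsub>H\<^esub> compose (carrier H) A B y)"
      using xy by (simp add: compose_def u_def w_def)
  qed
qed

section \<open>Hilbert spaces carried by the range of an injection\<close>

text \<open>The type \<open>'a\<close> has no vector space structure of its own, so that of
  \<open>'b\<close> is transported along \<open>g\<close>. For injective \<open>g\<close>,
  \<open>inv_into UNIV g\<close> reads off the coordinates of a point of the carrier.\<close>

definition image_inner_space :: "('b::real_inner \<Rightarrow> 'a) \<Rightarrow> 'a inner_space"
  where "image_inner_space g = \<lparr>carrier = range g, monoid.mult = (\<lambda>_ _. undefined), one = undefined,
    ring.zero = g 0, add = (\<lambda>x y. g (inv_into UNIV g x + inv_into UNIV g y)), smult = (\<lambda>a x. g (a *\<^sub>R inv_into UNIV g x)),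
    ip = (\<lambda>x y. inv_into UNIV g x \<bullet> inv_into UNIV g y)\<rparr>"

context
  fixes g :: "'b::{real_inner, complete_space} \<Rightarrow> 'a"
  assumes g: "inj g"
begin

interpretation image: inner_product_space "image_inner_space g"
proof -
  let ?H = "image_inner_space g"
  have grp: "abelian_group ?H"
    by (rule abelian_groupI)
      (auto simp: image_inner_space_def g algebra_simps inj_eq[OF g] intro: exI[of _ "- x" for x])
  have mod: "Module.module real_ring ?H"
    by (rule Module.moduleI[OF _ grp])
      (auto simp: image_inner_space_def g algebra_simps)
  show "inner_product_space ?H"
    by (intro inner_product_space.intro mod inner_product_space_axioms.intro)
      (auto simp: image_inner_space_def g inner_add_left intro: inner_commute)
qed

lemma inner_product_space_image: "inner_product_space (image_inner_space g)"
  by (rule image.inner_product_space_axioms)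

lemma carrier_image: "carrier (image_inner_space g) = range g"
  by (simp add: image_inner_space_def)

lemma ip_image: "ip (image_inner_space g) (g x) (g y) = x \<bullet> y"
  by (simp add: image_inner_space_def g)

lemma minus_image: "g x \<ominus>\<^bsub>image_inner_space g\<^esub> g y = g (x - y)"
proof -
  have "\<ominus>\<^bsub>image_inner_space g\<^esub> g y = g (- y)"
    using image.minus_eq_smult[of "g y"] by (simp add: image_inner_space_def g)
  then show ?thesis
    by (simp add: image.M.minus_eq) (simp add: image_inner_space_def g)
qed

lemma hdist_image: "hdist (image_inner_space g) (g x) (g y) = dist x y"
  by (simp add: hdist_def carrier_image minus_image ip_image dist_norm norm_eq_sqrt_inner)

text \<open>By \<open>hdist_image\<close>, \<open>g\<close> is an isometry onto the carrier: a
  Cauchy sequence is pulled back to \<open>'b\<close>, converges there by completeness, and its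
  limit is pushed forward.\<close>

lemma hilbert_space_image: "hilbert_space (image_inner_space g)"
proof -
  let ?H = "image_inner_space g"
  interpret M: Metric_space "carrier ?H" "hdist ?H" by (rule image.Metric_space)
  have "M.mcomplete"
    unfolding M.mcomplete_def
  proof (intro allI impI)
    fix \<sigma> assume s: "M.MCauchy \<sigma>"
    define f where "f n = inv_into UNIV g (\<sigma> n)" for n
    have fs: "\<sigma> n = g (f n)" for n
    proof -
      have "\<sigma> n \<in> range g"
        using s carrier_image unfolding M.MCauchy_def by blast
      then show ?thesis by (simp add: f_def f_inv_into_f)
    qed
    have "Cauchy f"
      using s unfolding M.MCauchy_def Cauchy_def by (simp add: fs hdist_image)
    then obtain l where "f \<longlonglongrightarrow> l"
      using Cauchy_convergent convergent_def by blast
    then have "limitin M.mtopology \<sigma> (g l) sequentially"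
      unfolding M.limit_metric_sequentially lim_sequentially
      by (simp add: fs hdist_image carrier_image)
    then show "\<exists>x. limitin M.mtopology \<sigma> x sequentially" ..
  qed
  then show ?thesis
    by (intro hilbert_space.intro inner_product_space_image hilbert_space_axioms.intro)
qed

end

section \<open>Multiplication operators on a copy of the complex plane\<close>

definition image_mult :: "(complex \<Rightarrow> 'a) \<Rightarrow> complex \<Rightarrow> 'a \<Rightarrow> 'a"
  where "image_mult g z = (\<lambda>x\<in>range g. g (z * inv_into UNIV g x))"

lemma compose_image_mult:
  assumes "inj g"
  shows "compose (range g) (image_mult g z) (image_mult g w) = image_mult g (z * w)"
  by (rule ext) (auto simp: compose_def image_mult_def assms algebra_simps)

text \<open>Multiplication by z scales all the quadratic terms by |d|^2, so only the sign of
  \<delta> = |z - (1 - \<theta>)|^2 - \<open>\<theta>\<^sup>2\<close> matters. The condition is a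
  disc with 1 on its boundary, which u = 1/(z - 1) turns into a half-plane.\<close>

lemma averaged_image_mult_iff:
  fixes g :: "complex \<Rightarrow> 'a"
  assumes g: "inj g" and \<theta>: "0 < \<theta>" "\<theta> < 1" and u: "u \<noteq> 0"
  shows "averaged (image_inner_space g) \<theta> (image_mult g (1 + 1 / u)) \<longleftrightarrow> Re u \<le> - 1 / (2 * \<theta>)"
proof -
  interpret H: inner_product_space "image_inner_space g" by (rule inner_product_space_image[OF g])
  define z where "z = 1 + 1 / u"
  have m: "image_mult g z (g x) = g (z * x)" for x by (simp add: image_mult_def g)
  define \<delta> where "\<delta> = (cmod z)\<^sup>2 + (1 - 2 * \<theta>) - 2 * (1 - \<theta>) * Re z"
  have in1: "(z * d) \<bullet> (z * d) = (cmod z)\<^sup>2 * (cmod d)\<^sup>2" for d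
    by (simp add: power2_norm_eq_inner[symmetric] norm_mult power_mult_distrib)
  have in2: "d \<bullet> (z * d) = Re z * (cmod d)\<^sup>2" for d
    unfolding cmod_power2 by (simp add: inner_complex_def power2_eq_square algebra_simps)
  have "averaged (image_inner_space g) \<theta> (image_mult g z) \<longleftrightarrow>
    (\<forall>x y. (z * (x - y)) \<bullet> (z * (x - y)) + (1 - 2 * \<theta>) * ((x - y) \<bullet> (x - y))
       \<le> 2 * (1 - \<theta>) * ((x - y) \<bullet> (z * (x - y))))"
    unfolding H.averaged_iff using \<theta>
    by (auto simp: carrier_image[OF g] m minus_image[OF g] ip_image[OF g] image_mult_def g
        right_diff_distrib)
  \<comment> \<open>By linearity only differences occur, and every d is d - 0.\<close>
  also have "\<dots> \<longleftrightarrow> (\<forall>d. (z * d) \<bullet> (z * d) + (1 - 2 * \<theta>) * (d \<bullet> d) \<le> 2 * (1 - \<theta>) * (d \<bullet> (z * d)))"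
    by (metis diff_zero)
  also have "\<dots> \<longleftrightarrow> (\<forall>d. \<delta> * (cmod d)\<^sup>2 \<le> 0)"
    unfolding in1 in2 unfolding power2_norm_eq_inner[symmetric] \<delta>_def by (simp add: algebra_simps)
  also have "\<dots> \<longleftrightarrow> \<delta> \<le> 0"
    by (auto simp: mult_le_0_iff dest: spec[of _ 1])
  also have "\<delta> = (cmod (1 / u))\<^sup>2 + 2 * \<theta> * Re (1 / u)"
    unfolding \<delta>_def z_def cmod_power2 by (simp add: power2_eq_square algebra_simps)
  also have "\<dots> = (1 + 2 * \<theta> * Re u) / (cmod u)\<^sup>2"
    using u by (simp add: norm_divide Re_divide cmod_power2 power_divide add_divide_distrib)
  also have "\<dots> \<le> 0 \<longleftrightarrow> Re u \<le> - 1 / (2 * \<theta>)"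
    using u \<theta> by (simp add: divide_le_0_iff field_simps) linarith
  finally show ?thesis by (simp add: z_def)
qed

text \<open>The real line is equinumerous with its square, so a universe at least as large as the
  line also has room for the plane.\<close>

lemma inj_complex_of_real_lepoll:
  assumes "(UNIV :: real set) \<lesssim> (UNIV :: 'a set)"
  obtains g :: "complex \<Rightarrow> 'a" where "inj g"
proof -
  obtain f :: "real \<Rightarrow> 'a" where f: "inj f" using assms by (auto simp: lepoll_def)
  obtain h :: "real \<times> real \<Rightarrow> real" where "bij_betw h (UNIV \<times> UNIV) UNIV"
    using card_of_Times_same_infinite[OF infinite_UNIV_char_0[where 'a = real]] card_of_ordIso
    by blast
  then have h: "inj h" by (simp add: bij_betw_def)
  have "inj (\<lambda>z. f (h (Re z, Im z)))"
    by (auto intro!: injI simp: inj_eq[OF f] inj_eq[OF h] complex_eq_iff)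
  then show ?thesis by (rule that)
qed

section \<open>Tightness of the coefficient\<close>

text \<open>The product of \<open>1 + 1 / u\<^sub>1\<close> and \<open>1 + 1 / u\<^sub>2\<close> is
  1 + 1/u with \<open>u = u\<^sub>1 * u\<^sub>2 / (1 + u\<^sub>1 + u\<^sub>2)\<close>. Both factors
  lie on the boundary of their half-planes, while Re u approaches - 1/(2 \<theta>) as t grows and so
  leaves the half-plane of any smaller \<theta>'.\<close>

lemma averaged_image_mult_tight:
  fixes g :: "complex \<Rightarrow> 'a" and \<theta>\<^sub>1 \<theta>\<^sub>2 \<theta> \<theta>' :: real
  assumes g: "inj g" and th: "\<theta>\<^sub>1 \<in> {0<..<1}" "\<theta>\<^sub>2 \<in> {0<..<1}"
    and \<theta>: "\<theta> = (\<theta>\<^sub>1 + \<theta>\<^sub>2 - 2 * \<theta>\<^sub>1 * \<theta>\<^sub>2) / (1 - \<theta>\<^sub>1 * \<theta>\<^sub>2)" and \<theta>': "\<theta>' \<in> {0<..<\<theta>}"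
  obtains z\<^sub>1 z\<^sub>2 where "averaged (image_inner_space g) \<theta>\<^sub>1 (image_mult g z\<^sub>1)"
    "averaged (image_inner_space g) \<theta>\<^sub>2 (image_mult g z\<^sub>2)"
    "\<not> averaged (image_inner_space g) \<theta>' (image_mult g (z\<^sub>1 * z\<^sub>2))"
proof -
  define p q where "p = 1 / \<theta>\<^sub>1 - 1" and "q = 1 / \<theta>\<^sub>2 - 1"
  note c = averaged_coefficient_inverse[OF th \<theta> p_def q_def]
  have "0 < 1 / \<theta>' - 1 / \<theta>" using \<theta>' c by (simp add: field_simps)
  then have e: "0 < (p + q) * (1 / \<theta>' - 1 / \<theta>)" using c by simp
  \<comment> \<open>Chosen so that the error term 1/((p + q) (1 + t^2)) in - 2 Re u falls below the
    gap 1/\<theta>' - 1/\<theta>. A linear bound on t is enough, since t <= 1 + t^2.\<close>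
  then obtain t :: nat where t: "1 / ((p + q) * (1 / \<theta>' - 1 / \<theta>)) < of_nat t"
    using reals_Archimedean2 by blast
  also have "real t \<le> 1 + (real t)\<^sup>2"
    using sum_squares_bound[of 1 "real t"] by simp
  finally have "1 < (1 + (real t)\<^sup>2) * ((p + q) * (1 / \<theta>' - 1 / \<theta>))"
    using e by (simp only: pos_divide_less_eq)
  then have "1 / ((p + q) * (1 + (real t)\<^sup>2)) < 1 / \<theta>' - 1 / \<theta>"
    using c by (simp add: pos_divide_less_eq add_pos_nonneg mult_ac)
  then have t: "1 + p * q / (p + q) + 1 / ((p + q) * (1 + (real t)\<^sup>2)) < 1 / \<theta>'"
    using c(5) by simp
  \<comment> \<open>Real part -1 gives \<open>u\<^sub>1\<close> the real part - (p + 1)/2, which is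
    the boundary value for \<open>\<theta>\<^sub>1\<close>; likewise for \<open>u\<^sub>2\<close>.
    Imaginary parts in proportion p : q make the estimate in \<open>averaged_compose\<close> sharp
    in the limit.\<close>
  define v where "v = Complex (-1) (real t)"
  define u\<^sub>1 where "u\<^sub>1 = (of_real p * v - 1) / 2"
  define u\<^sub>2 where "u\<^sub>2 = (of_real q * v - 1) / 2"
  \<comment> \<open>Here \<open>1 + u\<^sub>1 + u\<^sub>2\<close> is (p + q) v/2. Dividing the
    product by it leaves only the powers 1/v, 1 and v, so Re u can be read off.\<close>
  define u where "u = (1 / v - of_real (p + q) + of_real (p * q) * v) / of_real (2 * (p + q))"
  have r: "Re u\<^sub>1 = - 1 / (2 * \<theta>\<^sub>1)" "Re u\<^sub>2 = - 1 / (2 * \<theta>\<^sub>2)"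
    using th by (simp_all add: u\<^sub>1_def u\<^sub>2_def v_def p_def q_def field_simps)
  then have "Re u\<^sub>1 < 0" "Re u\<^sub>2 < 0" using th by auto
  then have nz: "u\<^sub>1 \<noteq> 0" "u\<^sub>2 \<noteq> 0" by auto
  have v: "v \<noteq> 0" by (simp add: v_def complex_eq_iff)
  have "Re (1 / v) = - 1 / (1 + (real t)\<^sup>2)"
    by (simp add: v_def Re_divide)
  moreover have "Re v = - 1" by (simp add: v_def)
  ultimately have "Re u = (- 1 / (1 + (real t)\<^sup>2) - (p + q) - p * q) / (2 * (p + q))"
    unfolding u_def Re_divide_of_real by simp
  also have "\<dots> = - (1 + p * q / (p + q) + 1 / ((p + q) * (1 + (real t)\<^sup>2))) / 2"
  proof -
    have "(- 1 / s - r - p * q) / (2 * r) = - (1 + p * q / r + 1 / (r * s)) / 2"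
      if "r > 0" "s > 0" for r s :: real
      using that by (simp add: field_simps)
    then show ?thesis using c(1,2) by (metis add_pos_pos add_pos_nonneg zero_less_one zero_le_power2)
  qed
  also have "\<dots> > - 1 / (2 * \<theta>')" using t by simp
  finally have ru: "Re u > - 1 / (2 * \<theta>')" .
  have pq: "(of_real (p + q) :: complex) \<noteq> 0" using c by (simp del: of_real_add)
  \<comment> \<open>Checks that the explicit u is the quotient it should be, after clearing the
    denominator 2 (p + q) v.\<close>
  have uv: "u * (2 * of_real (p + q) * v) = (of_real p * v - 1) * (of_real q * v - 1)"
  proof -
    have "(1 / v - r + s * v) / (2 * r) * (2 * r * v) = 1 - r * v + s * v\<^sup>2" if "r \<noteq> 0" for r s
      using that v by (simp add: field_simps power2_eq_square)
    from this[OF pq, of "of_real (p * q)"] show ?thesis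
      unfolding u_def by (simp add: algebra_simps power2_eq_square)
  qed
  also have "\<dots> = 4 * (u\<^sub>1 * u\<^sub>2)" by (simp add: u\<^sub>1_def u\<^sub>2_def)
  finally have uv: "u * (2 * of_real (p + q) * v) = 4 * (u\<^sub>1 * u\<^sub>2)" .
  then have u: "u \<noteq> 0" using nz by auto
  have s: "2 * of_real (p + q) * v = 4 * (1 + u\<^sub>1 + u\<^sub>2)"
    by (simp add: u\<^sub>1_def u\<^sub>2_def field_simps)
  have "4 * (u * (1 + u\<^sub>1 + u\<^sub>2)) = 4 * (u\<^sub>1 * u\<^sub>2)"
    using uv unfolding s by (simp only: mult.left_commute)
  then have "u * (1 + u\<^sub>1 + u\<^sub>2) = u\<^sub>1 * u\<^sub>2" by simp
  then have prod: "(1 + 1 / u\<^sub>1) * (1 + 1 / u\<^sub>2) = 1 + 1 / u"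
    using nz u by (simp add: field_simps)
  show ?thesis
  proof (rule that)
    show "averaged (image_inner_space g) \<theta>\<^sub>1 (image_mult g (1 + 1 / u\<^sub>1))"
      "averaged (image_inner_space g) \<theta>\<^sub>2 (image_mult g (1 + 1 / u\<^sub>2))"
      using th r nz by (simp_all add: averaged_image_mult_iff[OF g])
    show "\<not> averaged (image_inner_space g) \<theta>' (image_mult g ((1 + 1 / u\<^sub>1) * (1 + 1 / u\<^sub>2)))"
      using \<theta>' c(4) u ru by (simp add: prod averaged_image_mult_iff[OF g])
  qed
qed

section \<open>Inclusion and tightness for the classes of operators\<close>

theorem corollary1:
  fixes \<theta>\<^sub>1 \<theta>\<^sub>2 \<theta> :: real
  assumes "\<theta>\<^sub>1 \<in> {0<..<1}" and "\<theta>\<^sub>2 \<in> {0<..<1}"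
    and "\<theta> = (\<theta>\<^sub>1 + \<theta>\<^sub>2 - 2 * \<theta>\<^sub>1 * \<theta>\<^sub>2) / (1 - \<theta>\<^sub>1 * \<theta>\<^sub>2)"
  shows "class_comp (averaged_class \<theta>\<^sub>1) (averaged_class \<theta>\<^sub>2) \<subseteq> (averaged_class \<theta> :: 'a op_class) \<and>
    ((UNIV :: real set) \<lesssim> (UNIV :: 'a set) \<longrightarrow>
      (\<forall>\<theta>'\<in>{0<..<\<theta>}.
        \<not> class_comp (averaged_class \<theta>\<^sub>1) (averaged_class \<theta>\<^sub>2) \<subseteq> (averaged_class \<theta>' :: 'a op_class)))"
proof (intro conjI impI ballI)
  show "class_comp (averaged_class \<theta>\<^sub>1) (averaged_class \<theta>\<^sub>2) \<subseteq> (averaged_class \<theta> :: 'a op_class)"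
    using inner_product_space.averaged_compose[OF hilbert_space.axioms(1) _ _ assms(3)]
    by (auto simp: class_comp_def averaged_class_def)
next
  fix \<theta>' assume \<theta>': "\<theta>' \<in> {0<..<\<theta>}" and "(UNIV :: real set) \<lesssim> (UNIV :: 'a set)"
  then obtain g :: "complex \<Rightarrow> 'a" where g: "inj g" using inj_complex_of_real_lepoll by blast
  obtain z\<^sub>1 z\<^sub>2 where z: "averaged (image_inner_space g) \<theta>\<^sub>1 (image_mult g z\<^sub>1)"
    "averaged (image_inner_space g) \<theta>\<^sub>2 (image_mult g z\<^sub>2)"
    "\<not> averaged (image_inner_space g) \<theta>' (image_mult g (z\<^sub>1 * z\<^sub>2))"
    using averaged_image_mult_tight[OF g assms \<theta>'] .
  \<comment> \<open>Both factors act on the same copy of the plane, so their composition is a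
    counterexample inside the product of the classes.\<close>
  have "(image_inner_space g, image_mult g (z\<^sub>1 * z\<^sub>2))
      \<in> class_comp (averaged_class \<theta>\<^sub>1) (averaged_class \<theta>\<^sub>2)"
    using z(1,2) hilbert_space_image[OF g] compose_image_mult[OF g, of z\<^sub>1 z\<^sub>2] carrier_image[OF g]
    unfolding class_comp_def averaged_class_def
    by (intro CollectI exI[of _ "image_inner_space g"] exI[of _ "image_mult g z\<^sub>1"]
        exI[of _ "image_mult g z\<^sub>2"]) simp
  then show "\<not> class_comp (averaged_class \<theta>\<^sub>1) (averaged_class \<theta>\<^sub>2) \<subseteq> (averaged_class \<theta>' :: 'a op_class)"
    using z(3) by (auto simp: averaged_class_def)
qed

end
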